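(* Let $\delta\in(0,1]$, $\eta>0$, $\alpha\in[0,1]$. Let $(\gamma_t)_{t\ge1}$ be a non-increasing sequence of nonnegative reals with $\sum_{t\ge1}\gamma_t=1$, and set $\gamma_t=0$ for $t\le0$. Let $(\tilde\gamma_t)_{t\ge1}$ be a positive non-increasing sequence such that $\sum_{t=1}^T\delta^{T-t}\tilde\gamma_t\le1$ for all $T\ge1$. For an arbitrary sequence $(p_t)_{t\ge1}$ in $[0,1]$, define recursively $$\alpha_t=\alpha\,\eta\,\tilde\gamma_t+\alpha\sum_{j\ge1}\delta^{t-\rho_j}\gamma_{t-\rho_j},\qquad R_t=\mathbf 1\{p_t\le\alpha_t\},$$ where $\rho_j$ is the time of the $j$-th rejection (only the finitely many $j$ with $\rho_j<t$ contribute to the sum). Then: (i) for every $t$, $\alpha_t$ is a coordinatewise non-decreasing function of $(R_1,\dots,R_{t-1})\in\{0,1\}^{t-1}$; (ii) for every $T\ge1$, $$\frac{\sum_{t\le T}\delta^{T-t}\alpha_t}{R_\delta(T)+\eta}\le\alpha .$$ Moreover, in the case $\tilde\gamma_t=\max(\gamma_t,1-\delta)$, one has $\alpha_t\ge\alpha\,\eta\,(1-\delta)$ for all $t$.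
   Context: $R_\delta(T)=\sum_{t=1}^T\delta^{T-t}R_t$ is the decaying-memory rejection count. The time of the $j$-th rejection is $\rho_j=\min\{t\ge0:\sum_{i=1}^tR_i\ge j\}$, with $\rho_j=\infty$ if there is no such $t$; terms with $\rho_j\ge t$ are zero because $\gamma_s=0$ for $s\le0$. *)

theory Defs
  imports Complex_Main "HOL-Library.Extended_Nat"
begin

text \<open>
  Sequences indexed by \<open>t \<ge> 1\<close> are functions on \<^typ>\<open>nat\<close>; their value at \<open>0\<close> is never used.
  Rejection indicators are \<^typ>\<open>nat\<close>-valued, with values in \<open>{0, 1}\<close>.
\<close>

definition rejection_time :: "(nat \<Rightarrow> nat) \<Rightarrow> nat \<Rightarrow> enat" where
  "rejection_time R j =
     (if \<exists>t. j \<le> (\<Sum>i=1..t. R i) then enat (LEAST t. j \<le> (\<Sum>i=1..t. R i)) else \<infinity>)"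

text \<open>
  The level at time \<open>t\<close> as a function of an arbitrary rejection history \<open>R\<close>. Restricting the sum to
  the indices with \<open>\<rho>\<^sub>j < t\<close> implements the convention \<open>\<gamma>\<^sub>s = 0\<close> for \<open>s \<le> 0\<close>; this index set is
  finite by \<open>finite_past_rejections\<close> below.
\<close>

definition history_level ::
  "real \<Rightarrow> real \<Rightarrow> real \<Rightarrow> (nat \<Rightarrow> real) \<Rightarrow> (nat \<Rightarrow> real) \<Rightarrow> (nat \<Rightarrow> nat) \<Rightarrow> nat \<Rightarrow> real" where
  "history_level \<delta> \<eta> \<alpha> \<gamma> \<gamma>' R t =
     \<alpha> * \<eta> * \<gamma>' t +
     \<alpha> * (\<Sum>j\<in>{j. 1 \<le> j \<and> rejection_time R j < enat t}.
            \<delta> ^ (t - the_enat (rejection_time R j)) * \<gamma> (t - the_enat (rejection_time R j)))"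

text \<open>
  The history is cut off at \<open>t\<close> only to make the recursion well-founded;
  \<open>rejection_iff_le_level\<close> below is the recursion without the cut-off.
\<close>

function rejection ::
  "real \<Rightarrow> real \<Rightarrow> real \<Rightarrow> (nat \<Rightarrow> real) \<Rightarrow> (nat \<Rightarrow> real) \<Rightarrow> (nat \<Rightarrow> real) \<Rightarrow> nat \<Rightarrow> nat" where
  "rejection \<delta> \<eta> \<alpha> \<gamma> \<gamma>' p t =
     of_bool (p t \<le> history_level \<delta> \<eta> \<alpha> \<gamma> \<gamma>'
                (\<lambda>s. if s < t then rejection \<delta> \<eta> \<alpha> \<gamma> \<gamma>' p s else 0) t)"
  by auto
termination
  by (relation "measure (\<lambda>(\<delta>, \<eta>, \<alpha>, \<gamma>, \<gamma>', p, t). t)") auto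

declare rejection.simps [simp del]

definition test_level ::
  "real \<Rightarrow> real \<Rightarrow> real \<Rightarrow> (nat \<Rightarrow> real) \<Rightarrow> (nat \<Rightarrow> real) \<Rightarrow> (nat \<Rightarrow> real) \<Rightarrow> nat \<Rightarrow> real" where
  "test_level \<delta> \<eta> \<alpha> \<gamma> \<gamma>' p t =
     history_level \<delta> \<eta> \<alpha> \<gamma> \<gamma>' (rejection \<delta> \<eta> \<alpha> \<gamma> \<gamma>' p) t"

definition decayed_rejections :: "real \<Rightarrow> (nat \<Rightarrow> nat) \<Rightarrow> nat \<Rightarrow> real" where
  "decayed_rejections \<delta> R T = (\<Sum>t=1..T. \<delta> ^ (T - t) * real (R t))"

lemma rejection_time_less_iff:
  "rejection_time R j < enat t \<longleftrightarrow> (\<exists>s<t. j \<le> (\<Sum>i=1..s. R i))"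
proof
  assume lt: "rejection_time R j < enat t"
  then have ex: "\<exists>s. j \<le> (\<Sum>i=1..s. R i)"
  proof (rule contrapos_pp)
    assume no: "\<not> (\<exists>s. j \<le> (\<Sum>i=1..s. R i))"
    show "\<not> rejection_time R j < enat t"
      unfolding rejection_time_def if_not_P[OF no] by simp
  qed
  show "\<exists>s<t. j \<le> (\<Sum>i=1..s. R i)"
  proof (intro exI conjI)
    show "(LEAST s. j \<le> (\<Sum>i=1..s. R i)) < t"
      using lt unfolding rejection_time_def if_P[OF ex] by simp
  qed (rule LeastI_ex[OF ex])
next
  assume "\<exists>s<t. j \<le> (\<Sum>i=1..s. R i)"
  then obtain s where s: "s < t" "j \<le> (\<Sum>i=1..s. R i)" by blast
  have "(LEAST s. j \<le> (\<Sum>i=1..s. R i)) \<le> s" by (rule Least_le) (rule s(2))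
  then have "(LEAST s. j \<le> (\<Sum>i=1..s. R i)) < t" using s(1) by (rule le_less_trans)
  moreover have ex: "\<exists>s. j \<le> (\<Sum>i=1..s. R i)" using s(2) by (rule exI)
  ultimately show "rejection_time R j < enat t"
    unfolding rejection_time_def if_P[OF ex] by simp
qed

lemma finite_past_rejections: "finite {j. 1 \<le> j \<and> rejection_time R j < enat t}"
proof (rule finite_subset)
  show "{j. 1 \<le> j \<and> rejection_time R j < enat t} \<subseteq> (\<Union>s\<in>{..<t}. {..(\<Sum>i=1..s. R i)})"
    by (auto simp: rejection_time_less_iff)
qed auto

lemma rejection_time_cong:
  assumes eq: "\<And>s. 1 \<le> s \<Longrightarrow> s < t \<Longrightarrow> R s = R' s" and lt: "rejection_time R j < enat t"
  shows "rejection_time R' j = rejection_time R j"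
proof -
  have sums: "(\<Sum>i=1..s. R i) = (\<Sum>i=1..s. R' i)" if "s < t" for s
    using that by (intro sum.cong) (auto intro: eq)
  define m where "m = (LEAST s. j \<le> (\<Sum>i=1..s. R i))"
  from lt have ex: "\<exists>s. j \<le> (\<Sum>i=1..s. R i)"
    unfolding rejection_time_less_iff by blast
  have m: "j \<le> (\<Sum>i=1..m. R i)" unfolding m_def by (rule LeastI_ex[OF ex])
  have mt: "m < t"
    using lt unfolding rejection_time_def if_P[OF ex] m_def by simp
  have "(LEAST s. j \<le> (\<Sum>i=1..s. R' i)) = m"
  proof (rule Least_equality)
    show "j \<le> (\<Sum>i=1..m. R' i)" using m sums[OF mt] by simp
  next
    fix y assume y: "j \<le> (\<Sum>i=1..y. R' i)"
    show "m \<le> y"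
    proof (rule ccontr)
      assume "\<not> m \<le> y"
      then have "y < m" "y < t" using mt by auto
      with y sums have "j \<le> (\<Sum>i=1..y. R i)" by simp
      then have "m \<le> y" unfolding m_def by (rule Least_le)
      with \<open>y < m\<close> show False by simp
    qed
  qed
  moreover have ex': "\<exists>s. j \<le> (\<Sum>i=1..s. R' i)" using m sums[OF mt] by (intro exI[of _ m]) simp
  ultimately show ?thesis unfolding rejection_time_def if_P[OF ex] if_P[OF ex'] m_def by simp
qed

lemma history_level_cong:
  assumes eq: "\<And>s. 1 \<le> s \<Longrightarrow> s < t \<Longrightarrow> R s = R' s"
  shows "history_level \<delta> \<eta> \<alpha> \<gamma> \<gamma>' R t = history_level \<delta> \<eta> \<alpha> \<gamma> \<gamma>' R' t"
proof -
  let ?J = "\<lambda>R. {j. 1 \<le> j \<and> rejection_time R j < enat t}"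
  have time: "rejection_time R' j = rejection_time R j" if "rejection_time R j < enat t" for j
    using eq that by (rule rejection_time_cong)
  have time': "rejection_time R j = rejection_time R' j" if "rejection_time R' j < enat t" for j
    using eq[symmetric] that by (rule rejection_time_cong)
  have "?J R = ?J R'"
  proof (intro set_eqI iffI)
    fix j assume "j \<in> ?J R" then show "j \<in> ?J R'" using time[of j] by simp
  next
    fix j assume "j \<in> ?J R'" then show "j \<in> ?J R" using time'[of j] by simp
  qed
  then have "(\<Sum>j\<in>?J R. \<delta> ^ (t - the_enat (rejection_time R j)) * \<gamma> (t - the_enat (rejection_time R j)))
      = (\<Sum>j\<in>?J R'. \<delta> ^ (t - the_enat (rejection_time R' j)) * \<gamma> (t - the_enat (rejection_time R' j)))"
    by (rule sum.cong) (simp add: time')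
  then show ?thesis unfolding history_level_def by (rule arg_cong)
qed

lemma rejection_iff_le_level:
  "rejection \<delta> \<eta> \<alpha> \<gamma> \<gamma>' p t = of_bool (p t \<le> test_level \<delta> \<eta> \<alpha> \<gamma> \<gamma>' p t)"
proof -
  have "history_level \<delta> \<eta> \<alpha> \<gamma> \<gamma>' (\<lambda>s. if s < t then rejection \<delta> \<eta> \<alpha> \<gamma> \<gamma>' p s else 0) t
      = test_level \<delta> \<eta> \<alpha> \<gamma> \<gamma>' p t"
    unfolding test_level_def by (rule history_level_cong) simp
  then show ?thesis by (subst rejection.simps) simp
qed

end

theory Submission
  imports Defs
begin

text \<open>
  Reindexing by the rejection times turns \<open>\<alpha>\<^sub>t\<close> into
  \<open>\<alpha> \<eta> \<gamma>'\<^sub>t + \<alpha> (\<Sum>\<^sub>s\<^sub><\<^sub>t \<delta>\<^bsup>t-s\<^esup> \<gamma>\<^bsub>t-s\<^esub> R\<^sub>s)\<close>, which is linear in the rejections with nonnegative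
  coefficients. Exchanging the order of summation in \<open>\<Sum>\<^sub>t \<delta>\<^bsup>T-t\<^esup> \<alpha>\<^sub>t\<close>, each past rejection
  \<open>R\<^sub>s\<close> receives the weight \<open>\<alpha> \<delta>\<^bsup>T-s\<^esup>\<close> times a partial sum of \<open>\<gamma>\<close>, which is at most \<open>1\<close>.
\<close>

text \<open>Before \<open>t\<close> the cumulative count grows by at most 1 per step, so distinct
  \<open>j\<close> have distinct rejection times. Hence \<open>j \<mapsto> \<rho>\<^sub>j\<close> is
  a bijection from the indices with \<open>\<rho>\<^sub>j < t\<close> onto the times
  \<open>s < t\<close> with \<open>R s = 1\<close>, and the count \<open>?S\<close> is its
  inverse.\<close>

lemma sum_rejection_times:
  fixes f :: "nat \<Rightarrow> real" and R :: "nat \<Rightarrow> nat"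
  assumes R: "\<And>s. 1 \<le> s \<Longrightarrow> s < t \<Longrightarrow> R s \<in> {0, 1}"
  shows "(\<Sum>j\<in>{j. 1 \<le> j \<and> rejection_time R j < enat t}. f (the_enat (rejection_time R j)))
       = (\<Sum>s=1..<t. f s * real (R s))"
proof -
  let ?S = "\<lambda>n. \<Sum>i=1..n. R i"
  have S_Suc: "?S (Suc n) = ?S n + R (Suc n)" for n
    by simp
  have S_mono: "?S m \<le> ?S n" if "m \<le> n" for m n
    using that by (intro sum_mono2) auto
  have time: "\<exists>s. rejection_time R j = enat s \<and> s \<in> {1..<t} \<and> R s = 1 \<and> ?S s = j"
    if j: "1 \<le> j" "rejection_time R j < enat t" for j
  proof -
    define s where "s = (LEAST s. j \<le> ?S s)"
    from j(2) have ex: "\<exists>s. j \<le> ?S s"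
      unfolding rejection_time_less_iff by blast
    then have s: "rejection_time R j = enat s" and S_s: "j \<le> ?S s"
      unfolding rejection_time_def s_def by (simp_all only: if_True) (rule LeastI_ex)
    have "s < t" using j(2) s by simp
    \<comment> \<open>The count at time 0 is an empty sum, so \<open>1 \<le> j\<close> excludes it
      and \<open>s\<close> has a predecessor.\<close>
    have "s \<noteq> 0" using S_s j(1) by (cases "s = 0") auto
    then obtain n where n: "s = Suc n" by (cases s) auto
    \<comment> \<open>Minimality of \<open>s\<close> gives \<open>?S n < j \<le> ?S n + R s\<close>;
      with \<open>R s \<le> 1\<close> this forces \<open>R s = 1\<close> and
      \<open>?S s = j\<close>.\<close>
    have "\<not> j \<le> ?S n"
      using not_less_Least[of n "\<lambda>s. j \<le> ?S s"] n s_def by simp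
    moreover have "R s \<in> {0, 1}" using \<open>s < t\<close> n by (intro R) auto
    ultimately have "R s = 1 \<and> ?S s = j" using S_s S_Suc[of n] n by auto
    with s \<open>s < t\<close> n show ?thesis by auto
  qed
  have time_S: "rejection_time R (?S s) = enat s" if s: "s \<in> {1..<t}" "R s = 1" for s
  proof -
    obtain n where n: "s = Suc n" using s(1) by (cases s) auto
    \<comment> \<open>The count jumps at \<open>s\<close> because \<open>R s = 1\<close>, so no
      earlier time reaches the value \<open>?S s\<close>.\<close>
    have "(LEAST u. ?S s \<le> ?S u) = s"
    proof (rule Least_equality)
      fix y assume y: "?S s \<le> ?S y"
      show "s \<le> y"
      proof (rule ccontr)
        assume "\<not> s \<le> y"
        then have "?S y \<le> ?S n" using n by (intro S_mono) auto
        with y s(2) S_Suc[of n] n show False by simp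
      qed
    qed simp
    then show ?thesis unfolding rejection_time_def by auto
  qed
  have "(\<Sum>j\<in>{j. 1 \<le> j \<and> rejection_time R j < enat t}. f (the_enat (rejection_time R j)))
      = (\<Sum>s\<in>{s \<in> {1..<t}. R s = 1}. f s)"
  proof (rule sum.reindex_bij_witness[where i = ?S and j = "\<lambda>j. the_enat (rejection_time R j)"])
    fix s assume s: "s \<in> {s \<in> {1..<t}. R s = 1}"
    then show "the_enat (rejection_time R (?S s)) = s" using time_S by simp
    \<comment> \<open>Supplies \<open>1 \<le> ?S s\<close>, so that the index attached to
      \<open>s\<close> is admissible.\<close>
    have "R s \<le> ?S s" using s by (intro member_le_sum) auto
    then show "?S s \<in> {j. 1 \<le> j \<and> rejection_time R j < enat t}" using s time_S by simp
  qed (use time in fastforce)+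
  also have "\<dots> = (\<Sum>s\<in>{1..<t}. if R s = 1 then f s else 0)"
    by (rule sum.inter_filter) simp
  also have "\<dots> = (\<Sum>s=1..<t. f s * real (R s))"
    using R by (intro sum.cong) fastforce+
  finally show ?thesis .
qed

lemma history_level_eq:
  assumes "\<And>s. 1 \<le> s \<Longrightarrow> s < t \<Longrightarrow> R s \<in> {0, 1}"
  shows "history_level \<delta> \<eta> \<alpha> \<gamma> \<gamma>' R t =
    \<alpha> * \<eta> * \<gamma>' t + \<alpha> * (\<Sum>s=1..<t. \<delta> ^ (t - s) * \<gamma> (t - s) * real (R s))"
  unfolding history_level_def
  using sum_rejection_times[OF assms, where f = "\<lambda>s. \<delta> ^ (t - s) * \<gamma> (t - s)"] by simp

text \<open>In the linear form the two histories can be compared term by term: for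
  \<open>s < t\<close> the argument \<open>t - s\<close> is at least 1, so the coefficient of
  \<open>R s\<close> is nonnegative.\<close>

lemma history_level_mono:
  assumes "0 \<le> \<delta>" "0 \<le> \<alpha>" and \<gamma>: "\<And>t. 1 \<le> t \<Longrightarrow> 0 \<le> \<gamma> t"
    and R: "\<And>s. 1 \<le> s \<Longrightarrow> s < t \<Longrightarrow> R s \<in> {0, 1} \<and> R' s \<in> {0, 1} \<and> R s \<le> R' s"
  shows "history_level \<delta> \<eta> \<alpha> \<gamma> \<gamma>' R t \<le> history_level \<delta> \<eta> \<alpha> \<gamma> \<gamma>' R' t"
proof -
  have "(\<Sum>s=1..<t. \<delta> ^ (t - s) * \<gamma> (t - s) * real (R s))
      \<le> (\<Sum>s=1..<t. \<delta> ^ (t - s) * \<gamma> (t - s) * real (R' s))"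
    using assms by (intro sum_mono mult_left_mono mult_nonneg_nonneg) auto
  moreover have "R s \<in> {0, 1}" "R' s \<in> {0, 1}" if "1 \<le> s" "s < t" for s
    using R[OF that] by blast+
  ultimately show ?thesis
    using \<open>0 \<le> \<alpha>\<close> by (simp add: history_level_eq mult_left_mono)
qed

text \<open>The linear form applies to the actual rejections because \<open>rejection\<close> is an
  \<open>of_bool\<close> and so takes only the values 0 and 1.\<close>

lemma test_level_eq:
  "test_level \<delta> \<eta> \<alpha> \<gamma> \<gamma>' p t = \<alpha> * \<eta> * \<gamma>' t +
    \<alpha> * (\<Sum>s=1..<t. \<delta> ^ (t - s) * \<gamma> (t - s) * real (rejection \<delta> \<eta> \<alpha> \<gamma> \<gamma>' p s))"
  unfolding test_level_def by (rule history_level_eq) (simp add: rejection_iff_le_level)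

text \<open>The decay factors multiply to \<open>\<delta> ^ (T - s)\<close>, which does not depend
  on \<open>t\<close>. Summing over \<open>t\<close> first therefore involves only values of
  \<open>\<gamma>\<close>, with total at most 1.\<close>

lemma decayed_convolution_le:
  fixes \<delta> :: real and \<gamma> :: "nat \<Rightarrow> real" and R :: "nat \<Rightarrow> nat"
  assumes "0 \<le> \<delta>" and \<gamma>: "\<And>t. 1 \<le> t \<Longrightarrow> 0 \<le> \<gamma> t" and \<gamma>_sums: "(\<lambda>n. \<gamma> (Suc n)) sums 1"
  shows "(\<Sum>t=1..T. \<delta> ^ (T - t) * (\<Sum>s=1..<t. \<delta> ^ (t - s) * \<gamma> (t - s) * real (R s)))
    \<le> decayed_rejections \<delta> R T"
proof -
  have \<gamma>_le: "(\<Sum>t=Suc s..T. \<gamma> (t - s)) \<le> 1" for s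
  proof -
    \<comment> \<open>The shift \<open>t = Suc n + s\<close> produces an initial segment of the
      series; for \<open>T \<le> s\<close> both sides are empty.\<close>
    have "(\<Sum>t=Suc s..T. \<gamma> (t - s)) = (\<Sum>n<T - s. \<gamma> (Suc n))"
      by (rule sum.reindex_bij_witness[where i = "\<lambda>n. Suc n + s" and j = "\<lambda>t. t - Suc s"])
        (auto simp: Suc_diff_Suc)
    also have "\<dots> \<le> 1"
      using sum_le_suminf[OF sums_summable[OF \<gamma>_sums], of "{..<T - s}"] \<gamma> sums_unique[OF \<gamma>_sums]
      by simp
    finally show ?thesis .
  qed
  have "(\<Sum>t=1..T. \<delta> ^ (T - t) * (\<Sum>s=1..<t. \<delta> ^ (t - s) * \<gamma> (t - s) * real (R s)))
      = (\<Sum>t=1..T. \<Sum>s=1..<t. \<delta> ^ (T - s) * real (R s) * \<gamma> (t - s))"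
  proof (intro sum.cong refl)
    fix t assume t: "t \<in> {1..T}"
    have "\<delta> ^ (T - t) * \<delta> ^ (t - s) = \<delta> ^ (T - s)" if "s < t" for s
      using t that by (simp flip: power_add)
    then show "\<delta> ^ (T - t) * (\<Sum>s=1..<t. \<delta> ^ (t - s) * \<gamma> (t - s) * real (R s))
        = (\<Sum>s=1..<t. \<delta> ^ (T - s) * real (R s) * \<gamma> (t - s))"
      unfolding sum_distrib_left by (intro sum.cong refl) (simp flip: mult.assoc)
  qed
  \<comment> \<open>Both double sums run over the pairs
    \<open>1 \<le> s < t \<le> T\<close>.\<close>
  also have "\<dots> = (\<Sum>s=1..T. \<Sum>t=Suc s..T. \<delta> ^ (T - s) * real (R s) * \<gamma> (t - s))"
    unfolding sum.Sigma[OF finite_atLeastAtMost ballI[OF finite_atLeastLessThan]]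
      sum.Sigma[OF finite_atLeastAtMost ballI[OF finite_atLeastAtMost]]
    by (rule sum.reindex_bij_witness[where i = prod.swap and j = prod.swap]) auto
  also have "\<dots> = (\<Sum>s=1..T. \<delta> ^ (T - s) * real (R s) * (\<Sum>t=Suc s..T. \<gamma> (t - s)))"
    by (simp add: sum_distrib_left)
  also have "\<dots> \<le> (\<Sum>s=1..T. \<delta> ^ (T - s) * real (R s))"
    using \<open>0 \<le> \<delta>\<close> by (intro sum_mono mult_left_le \<gamma>_le) auto
  finally show ?thesis unfolding decayed_rejections_def .
qed

text \<open>The numerator splits into two parts: the \<open>\<gamma>'\<close> part is at most
  \<open>\<alpha> * \<eta>\<close> by the budget on \<open>\<gamma>'\<close>, and the rejection part
  is at most \<open>\<alpha>\<close> times the decayed count. Together they give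
  \<open>\<alpha>\<close> times the denominator.\<close>

lemma decayed_level_ratio_le:
  assumes "0 \<le> \<delta>" "0 < \<eta>" "0 \<le> \<alpha>"
    and "\<And>t. 1 \<le> t \<Longrightarrow> 0 \<le> \<gamma> t" "(\<lambda>n. \<gamma> (Suc n)) sums 1"
    and \<gamma>': "(\<Sum>t=1..T. \<delta> ^ (T - t) * \<gamma>' t) \<le> 1"
  shows "(\<Sum>t=1..T. \<delta> ^ (T - t) * test_level \<delta> \<eta> \<alpha> \<gamma> \<gamma>' p t)
    / (decayed_rejections \<delta> (rejection \<delta> \<eta> \<alpha> \<gamma> \<gamma>' p) T + \<eta>) \<le> \<alpha>"
proof -
  let ?R = "rejection \<delta> \<eta> \<alpha> \<gamma> \<gamma>' p"
  have "(\<Sum>t=1..T. \<delta> ^ (T - t) * test_level \<delta> \<eta> \<alpha> \<gamma> \<gamma>' p t)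
      = \<alpha> * (\<eta> * (\<Sum>t=1..T. \<delta> ^ (T - t) * \<gamma>' t)
        + (\<Sum>t=1..T. \<delta> ^ (T - t) * (\<Sum>s=1..<t. \<delta> ^ (t - s) * \<gamma> (t - s) * real (?R s))))"
    by (simp add: test_level_eq distrib_left sum.distrib sum_distrib_left mult_ac)
  also have "\<dots> \<le> \<alpha> * (\<eta> * 1 + decayed_rejections \<delta> ?R T)"
    using assms by (intro mult_left_mono add_mono decayed_convolution_le) auto
  finally have "(\<Sum>t=1..T. \<delta> ^ (T - t) * test_level \<delta> \<eta> \<alpha> \<gamma> \<gamma>' p t)
      \<le> \<alpha> * (decayed_rejections \<delta> ?R T + \<eta>)"
    by (simp add: add.commute)
  \<comment> \<open>With \<open>0 < \<eta>\<close> this makes the denominator positive, so the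
    division can be cleared.\<close>
  moreover have "0 \<le> decayed_rejections \<delta> ?R T"
    unfolding decayed_rejections_def using \<open>0 \<le> \<delta>\<close> by (intro sum_nonneg) simp
  ultimately show ?thesis using \<open>0 < \<eta>\<close> by (simp add: pos_divide_le_eq)
qed

text \<open>Past rejections only add nonnegative terms to the level, so the \<open>\<gamma>'\<close>
  term alone is a lower bound.\<close>

lemma test_level_ge:
  assumes "0 \<le> \<delta>" "0 \<le> \<alpha>" "\<And>t. 1 \<le> t \<Longrightarrow> 0 \<le> \<gamma> t"
  shows "\<alpha> * \<eta> * \<gamma>' t \<le> test_level \<delta> \<eta> \<alpha> \<gamma> \<gamma>' p t"
  unfolding test_level_eq using assms by (auto intro!: sum_nonneg mult_nonneg_nonneg)

theorem mainTheorem2: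
  fixes \<delta> \<eta> \<alpha> :: real and \<gamma> \<gamma>' p :: "nat \<Rightarrow> real"
  assumes "0 < \<delta>" and "\<delta> \<le> 1"
    and "0 < \<eta>"
    and "0 \<le> \<alpha>" and "\<alpha> \<le> 1"
    and "\<forall>t\<ge>1. 0 \<le> \<gamma> t" and "antimono_on {1..} \<gamma>" and "(\<lambda>n. \<gamma> (Suc n)) sums 1"
    and "\<forall>t\<ge>1. 0 < \<gamma>' t" and "antimono_on {1..} \<gamma>'"
    and "\<forall>T\<ge>1. (\<Sum>t=1..T. \<delta> ^ (T - t) * \<gamma>' t) \<le> 1"
    and "\<forall>t\<ge>1. 0 \<le> p t \<and> p t \<le> 1"
  shows "(\<forall>t\<ge>1. \<forall>R R'. (\<forall>s\<in>{1..<t}. R s \<in> {0, 1} \<and> R' s \<in> {0, 1} \<and> R s \<le> R' s) \<longrightarrow>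
            history_level \<delta> \<eta> \<alpha> \<gamma> \<gamma>' R t \<le> history_level \<delta> \<eta> \<alpha> \<gamma> \<gamma>' R' t)
       \<and> (\<forall>T\<ge>1. (\<Sum>t=1..T. \<delta> ^ (T - t) * test_level \<delta> \<eta> \<alpha> \<gamma> \<gamma>' p t)
              / (decayed_rejections \<delta> (rejection \<delta> \<eta> \<alpha> \<gamma> \<gamma>' p) T + \<eta>) \<le> \<alpha>)
       \<and> ((\<forall>t\<ge>1. \<gamma>' t = max (\<gamma> t) (1 - \<delta>)) \<longrightarrow>
            (\<forall>t\<ge>1. test_level \<delta> \<eta> \<alpha> \<gamma> \<gamma>' p t \<ge> \<alpha> * \<eta> * (1 - \<delta>)))"
proof (intro conjI allI impI)
  fix t :: nat and R R' :: "nat \<Rightarrow> nat"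
  assume "\<forall>s\<in>{1..<t}. R s \<in> {0, 1} \<and> R' s \<in> {0, 1} \<and> R s \<le> R' s"
  then show "history_level \<delta> \<eta> \<alpha> \<gamma> \<gamma>' R t \<le> history_level \<delta> \<eta> \<alpha> \<gamma> \<gamma>' R' t"
    using assms by (intro history_level_mono) auto
next
  fix T :: nat assume "1 \<le> T"
  then show "(\<Sum>t=1..T. \<delta> ^ (T - t) * test_level \<delta> \<eta> \<alpha> \<gamma> \<gamma>' p t)
      / (decayed_rejections \<delta> (rejection \<delta> \<eta> \<alpha> \<gamma> \<gamma>' p) T + \<eta>) \<le> \<alpha>"
    using assms by (intro decayed_level_ratio_le) auto
next
  fix t :: nat assume \<gamma>': "\<forall>t\<ge>1. \<gamma>' t = max (\<gamma> t) (1 - \<delta>)" and "1 \<le> t"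
  \<comment> \<open>The maximum defining \<open>\<gamma>' t\<close> dominates
    \<open>1 - \<delta>\<close>, and \<open>\<alpha> * \<eta>\<close> is nonnegative.\<close>
  then have "\<alpha> * \<eta> * (1 - \<delta>) \<le> \<alpha> * \<eta> * \<gamma>' t"
    using assms(3,4) by (intro mult_left_mono) auto
  also have "\<dots> \<le> test_level \<delta> \<eta> \<alpha> \<gamma> \<gamma>' p t"
    using assms(1,4,6) by (intro test_level_ge) auto
  finally show "\<alpha> * \<eta> * (1 - \<delta>) \<le> test_level \<delta> \<eta> \<alpha> \<gamma> \<gamma>' p t" .
qed

end
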